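(* Let $n$ be a positive integer and let $i, j, k, \ell$ be non-negative integers with $j > \ell$ and $kj + i + \ell < n$. Then the circulant digraph $C_n^{i,j,k,\ell}$ is singular if and only if either $\gcd(\ell+1, n) \ge 2$ or $\gcd\left(k+1, \frac{n}{\gcd(n,j)}\right) \ge 2$.
   Context: An $n \times n$ matrix $A = [a_{uv}]$ is circulant if each row after the first is obtained by cyclically shifting the previous row one position to the right; it is thus determined by its first row. If the first row is $[a_0, a_1, \ldots, a_{n-1}]$, the representer polynomial of $A$ is $\gamma_A(x) = a_0 + a_1 x + \cdots + a_{n-1}x^{n-1}$, so that $A = \gamma_A(W_n)$ where $W_n$ is the circulant matrix with first row $[0,1,0,\ldots,0]$. A digraph (loops allowed) is circulant if its adjacency matrix is circulant, and it is called singular (non-singular) if its adjacency matrix is singular (non-singular). For non-negative integers $i,j,k,\ell$ with $j > \ell$ and $kj+i+\ell < n$, $C_n^{i,j,k,\ell}$ denotes the circulant digraph on $n$ vertices whose adjacency matrix has representer polynomial $$\sum_{t=0}^{k}\sum_{s=i}^{i+\ell} x^{s+tj}.$$ *)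

theory Defs
  imports "Graph_Theory.Pair_Digraph" "Jordan_Normal_Form.Determinant"
begin

text \<open>
  A digraph of order \<open>n\<close> (loops allowed, no parallel arcs) has vertex set \<open>{0..<n}\<close>;
  vertex \<open>u\<close> labels row and column \<open>u\<close> of the adjacency matrix.
\<close>

definition adjacency_mat :: "nat pair_pre_digraph \<Rightarrow> real mat" where
  "adjacency_mat G = mat (card (pverts G)) (card (pverts G))
     (\<lambda>(u, v). if (u, v) \<in> parcs G then 1 else 0)"

definition singular_mat :: "real mat \<Rightarrow> bool" where
  "singular_mat A \<longleftrightarrow> square_mat A \<and> det A = 0"

definition singular_digraph :: "nat pair_pre_digraph \<Rightarrow> bool" where
  "singular_digraph G \<longleftrightarrow> singular_mat (adjacency_mat G)"

definition circulant_mat :: "real mat \<Rightarrow> bool" where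
  "circulant_mat A \<longleftrightarrow> square_mat A \<and>
     (\<forall>u v. Suc u < dim_row A \<and> v < dim_col A \<longrightarrow>
        A $$ (Suc u, Suc v mod dim_col A) = A $$ (u, v))"

definition representer_poly :: "real mat \<Rightarrow> real poly" where
  "representer_poly A = (\<Sum>v<dim_col A. monom (A $$ (0, v)) v)"

definition circulant_digraph :: "nat \<Rightarrow> real poly \<Rightarrow> nat pair_pre_digraph" where
  "circulant_digraph n p = \<lparr> pverts = {0..<n},
     parcs = {(u, v). u < n \<and> v < n \<and> coeff p ((v + n - u) mod n) = 1} \<rparr>"

definition C_poly :: "nat \<Rightarrow> nat \<Rightarrow> nat \<Rightarrow> nat \<Rightarrow> real poly" where
  "C_poly i j k l = (\<Sum>t=0..k. \<Sum>s=i..i+l. monom 1 (s + t * j))"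

definition C_digraph :: "nat \<Rightarrow> nat \<Rightarrow> nat \<Rightarrow> nat \<Rightarrow> nat \<Rightarrow> nat pair_pre_digraph" where
  "C_digraph n i j k l = circulant_digraph n (C_poly i j k l)"

text \<open>
  The lemmas below show that \<open>C_digraph n i j k l\<close> is the unique digraph on \<open>{0..<n}\<close>
  whose adjacency matrix is circulant with representer polynomial \<open>C_poly i j k l\<close>.
\<close>

lemma pair_fin_digraph_C_digraph: "pair_fin_digraph (C_digraph n i j k l)"
proof
  have "parcs (C_digraph n i j k l) \<subseteq> {0..<n} \<times> {0..<n}"
    by (auto simp: C_digraph_def circulant_digraph_def)
  then show "finite (parcs (C_digraph n i j k l))"
    by (rule finite_subset) simp
qed (auto simp: C_digraph_def circulant_digraph_def)

lemma circulant_mat_entry: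
  assumes A: "circulant_mat A" "A \<in> carrier_mat n n" and "u < n" "v < n"
  shows "A $$ (u, v) = A $$ (0, (v + n - u) mod n)"
  using assms(3,4)
proof (induction u arbitrary: v)
  case 0
  then show ?case by simp
next
  case (Suc u)
  define w where "w = (if v = 0 then n - 1 else v - 1)"
  have w: "w < n" "Suc w mod n = v"
    using Suc.prems by (auto simp: w_def)
  have "A $$ (Suc u, Suc w mod n) = A $$ (u, w)"
    using A Suc.prems w(1) by (auto simp: circulant_mat_def)
  also have "\<dots> = A $$ (0, (w + n - u) mod n)"
    using Suc w by simp
  also have "(w + n - u) mod n = (v + n - Suc u) mod n"
  proof (cases "v = 0")
    case True
    then have "w + n - u = (n - Suc u) + n" using Suc.prems by (simp add: w_def)
    then show ?thesis using True by simp
  next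
    case False
    then have "w + n - u = v + n - Suc u" by (simp add: w_def)
    then show ?thesis by simp
  qed
  finally show ?case using w by simp
qed

lemma circulant_mat_adjacency: "circulant_mat (adjacency_mat (circulant_digraph n p))"
proof -
  have "(Suc v mod n + n - Suc u) mod n = (v + n - u) mod n" if "Suc u < n" "v < n" for u v
  proof (cases "Suc v = n")
    case True
    have "v + n - u = n - Suc u + n" using that True by simp
    then have "(v + n - u) mod n = (n - Suc u) mod n" by simp
    moreover have "Suc v mod n = 0" using True by simp
    ultimately show ?thesis by simp
  next
    case False
    then show ?thesis using that by simp
  qed
  then have "adjacency_mat (circulant_digraph n p) $$ (Suc u, Suc v mod n) =
      adjacency_mat (circulant_digraph n p) $$ (u, v)" if "Suc u < n" "v < n" for u v
    using that by (simp add: adjacency_mat_def circulant_digraph_def)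
  moreover have "adjacency_mat (circulant_digraph n p) \<in> carrier_mat n n"
    by (simp add: adjacency_mat_def circulant_digraph_def)
  ultimately show ?thesis
    by (simp add: circulant_mat_def)
qed

lemma coeff_C_poly:
  assumes "j > l"
  shows "coeff (C_poly i j k l) m =
           (if \<exists>t\<le>k. \<exists>s\<in>{i..i+l}. m = s + t * j then 1 else 0)"
proof -
  let ?S = "{(t, s). t \<le> k \<and> s \<in> {i..i+l} \<and> s + t * j = m}"
  have fin: "finite ?S"
    by (rule finite_subset[of _ "{0..k} \<times> {i..i+l}"]) auto
  have "coeff (C_poly i j k l) m =
        (\<Sum>(t, s)\<in>{0..k} \<times> {i..i+l}. if s + t * j = m then 1 else 0)"
    by (simp add: C_poly_def coeff_sum sum.cartesian_product split_beta)
  also have "\<dots> = (\<Sum>x\<in>?S. 1)"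
    by (rule sum.mono_neutral_cong_right) (auto split: if_splits)
  also have "\<dots> = real (card ?S)" by simp
  finally have eq: "coeff (C_poly i j k l) m = real (card ?S)" .
  have uniq: "x = y" if "x \<in> ?S" "y \<in> ?S" for x y
  proof -
    obtain t s t' s' where xy: "x = (t, s)" "y = (t', s')" by (metis surj_pair)
    have s: "i \<le> s" "s \<le> i + l" "i \<le> s'" "s' \<le> i + l" "s + t * j = s' + t' * j"
      using that xy by auto
    have d: "(s - i) + t * j = (s' - i) + t' * j" using s by linarith
    have div: "(a + q * j) div j = q" if "a < j" for a q
      using that by simp
    have "s - i < j" "s' - i < j" using s assms by linarith+
    then have "((s - i) + t * j) div j = t" "((s' - i) + t' * j) div j = t'"
      by (simp_all only: div)
    then have "t = t'" unfolding d by simp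
    then show ?thesis using s xy by simp
  qed
  show ?thesis
  proof (cases "?S = {}")
    case True
    then have "\<not> (\<exists>t\<le>k. \<exists>s\<in>{i..i+l}. m = s + t * j)" by fastforce
    then show ?thesis unfolding eq True by auto
  next
    case False
    then obtain x where "x \<in> ?S" by blast
    then have "?S = {x}" using uniq by blast
    then have "card ?S = 1" by simp
    moreover have "\<exists>t\<le>k. \<exists>s\<in>{i..i+l}. m = s + t * j" using False by auto
    ultimately show ?thesis using eq by auto
  qed
qed

lemma coeff_representer_poly:
  "coeff (representer_poly A) m = (if m < dim_col A then A $$ (0, m) else 0)"
  by (simp add: representer_poly_def coeff_sum)

lemma representer_poly_C_digraph:
  assumes "j > l" "k * j + i + l < n"
  shows "representer_poly (adjacency_mat (C_digraph n i j k l)) = C_poly i j k l"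
proof (rule poly_eqI)
  fix m
  have "coeff (C_poly i j k l) m = 0" if "\<not> m < n"
  proof -
    have "s + t * j < n" if "t \<le> k" "s \<le> i + l" for t s
      using mult_le_mono1[OF that(1), of j] that(2) assms(2) by linarith
    then show ?thesis
      using \<open>\<not> m < n\<close> by (auto simp: coeff_C_poly[OF assms(1)])
  qed
  moreover have "coeff (C_poly i j k l) m = 0 \<or> coeff (C_poly i j k l) m = 1"
    unfolding coeff_C_poly[OF assms(1)] by simp
  ultimately show "coeff (representer_poly (adjacency_mat (C_digraph n i j k l))) m =
             coeff (C_poly i j k l) m"
    by (cases "m < n")
       (auto simp: coeff_representer_poly adjacency_mat_def C_digraph_def circulant_digraph_def)
qed

lemma C_digraph_unique:
  assumes G: "pair_wf_digraph G" "pverts G = {0..<n}"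
    and circ: "circulant_mat (adjacency_mat G)"
    and rep: "representer_poly (adjacency_mat G) = C_poly i j k l"
  shows "G = C_digraph n i j k l"
proof -
  have dim: "adjacency_mat G \<in> carrier_mat n n"
    using G(2) by (simp add: adjacency_mat_def)
  have "(u, v) \<in> parcs G \<longleftrightarrow> coeff (C_poly i j k l) ((v + n - u) mod n) = 1"
    if "u < n" "v < n" for u v
  proof -
    have "(u, v) \<in> parcs G \<longleftrightarrow> adjacency_mat G $$ (u, v) = 1"
      using that G(2) by (simp add: adjacency_mat_def)
    also have "adjacency_mat G $$ (u, v) = coeff (C_poly i j k l) ((v + n - u) mod n)"
      using circulant_mat_entry[OF circ dim that] dim that
      by (simp flip: rep add: coeff_representer_poly)
    finally show ?thesis .
  qed
  moreover have "u < n \<and> v < n" if "(u, v) \<in> parcs G" for u v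
    using pair_wf_digraph.in_arcsD1[OF G(1) that] pair_wf_digraph.in_arcsD2[OF G(1) that] G(2)
    by simp
  ultimately have "(u, v) \<in> parcs G \<longleftrightarrow> (u, v) \<in> parcs (C_digraph n i j k l)" for u v
    unfolding C_digraph_def circulant_digraph_def
      pair_pre_digraph.select_convs mem_Collect_eq prod.case by blast
  then have "parcs G = parcs (C_digraph n i j k l)"
    unfolding set_eq_iff split_paired_All by blast
  then show ?thesis
    using G(2) by (simp add: C_digraph_def circulant_digraph_def)
qed

end

theory Submission
  imports Defs
begin

text \<open>
  For \<open>z ^ n = 1\<close> the vector \<open>(1, z, \<dots>, z ^ (n - 1))\<close> is an eigenvector of a circulant matrix
  for the eigenvalue \<open>\<gamma>(z)\<close>, where \<open>\<gamma>\<close> is the representer polynomial. These eigenvectors span,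
  because a nonzero polynomial of degree below \<open>n\<close> cannot vanish at all \<open>n\<close>-th roots of unity;
  so the matrix is singular iff \<open>\<gamma>\<close> vanishes at one of them. Here
  \<open>\<gamma>(z) = z ^ i (1 + z + \<dots> + z ^ l) (1 + z ^ j + \<dots> + z ^ (k j))\<close>, so one of the geometric
  sums vanishes: either \<open>z\<close> is a nontrivial \<open>(l + 1)\<close>-th root of unity, or
  \<open>z ^ j\<close> is a nontrivial \<open>(k + 1)\<close>-th root of unity. As \<open>z\<close> ranges over the \<open>n\<close>-th roots of
  unity, \<open>z ^ j\<close> ranges over the roots of order dividing \<open>n div gcd n j\<close>.
\<close>

section \<open>Roots of unity\<close>

lemma power_gcd_eq_1:
  fixes z :: "'a :: field"
  assumes "z ^ a = 1" "z ^ b = 1"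
  shows "z ^ gcd a b = 1"
proof (cases "a = 0")
  case False
  \<comment> \<open>Bezout over the naturals keeps all exponents nonnegative, at the price of
    requiring \<open>a\<close> to be nonzero.\<close>
  then obtain x y where "a * x = b * y + gcd a b"
    using bezout_nat by blast
  then have "(z ^ a) ^ x = (z ^ b) ^ y * z ^ gcd a b"
    by (simp flip: power_mult power_add)
  then show ?thesis
    using assms by simp
qed (use assms in simp)

lemma power_mod_eq:
  fixes z :: "'a :: monoid_mult"
  assumes "z ^ n = 1"
  shows "z ^ (m mod n) = z ^ m"
proof -
  have "z ^ m = (z ^ n) ^ (m div n) * z ^ (m mod n)"
    by (simp flip: power_mult power_add)
  then show ?thesis
    using assms by simp
qed

text \<open>The powers of \<open>cis (2 * pi / real m)\<close> with exponents below \<open>m\<close>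
  are distinct, so its order is exactly \<open>m\<close>. Phrased as divisibility, this reduces the
  later choice of a witness to arithmetic.\<close>

lemma primitive_root_of_unity:
  assumes "m > 0"
  obtains z :: complex where "\<And>e. z ^ e = 1 \<longleftrightarrow> m dvd e"
proof
  fix e
  let ?z = "cis (2 * pi / real m)"
  have pow: "?z ^ e = cis (2 * pi * real e / real m)" for e
    by (simp add: DeMoivre mult_ac)
  have "?z ^ m = 1"
    using assms by (simp add: pow)
  then have "?z ^ e = ?z ^ (e mod m)"
    by (simp add: power_mod_eq)
  moreover have "inj_on (\<lambda>e. cis (2 * pi * real e / real m)) {..<m}"
    using bij_betw_roots_unity[OF assms] by (rule bij_betw_imp_inj_on)
  then have "?z ^ (e mod m) = ?z ^ 0 \<longleftrightarrow> e mod m = 0"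
    unfolding pow using assms by (intro inj_on_eq_iff) auto
  ultimately show "?z ^ e = 1 \<longleftrightarrow> m dvd e"
    by (simp add: dvd_eq_mod_eq_0)
qed

lemma geometric_sum_eq_0_iff:
  fixes z :: "'a :: field_char_0"
  shows "(\<Sum>s\<le>m. z ^ s) = 0 \<longleftrightarrow> z \<noteq> 1 \<and> z ^ Suc m = 1"
proof (cases "z = 1")
  case True
  have "(of_nat (Suc m) :: 'a) \<noteq> 0"
    by (rule of_nat_neq_0)
  then show ?thesis
    using True by simp
next
  case False
  then show ?thesis
    by (simp add: sum_gp0)
qed

text \<open>Serves both gcd conditions: \<open>j = 1\<close> with \<open>c = l + 1\<close> gives the
  first, and \<open>c = k + 1\<close> the second.\<close>

lemma ex_nontrivial_root_iff:
  fixes n j c :: nat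
  assumes "n > 0"
  shows "(\<exists>z::complex. z ^ n = 1 \<and> z ^ j \<noteq> 1 \<and> (z ^ j) ^ c = 1) \<longleftrightarrow> gcd c (n div gcd n j) \<ge> 2"
proof
  let ?g = "gcd n j" and ?d = "gcd c (n div gcd n j)"
  have "n div ?g > 0"
    using assms by (simp add: div_greater_zero_iff gcd_le1_nat)
  then have d: "?d > 0"
    by simp
  {
    assume "\<exists>z::complex. z ^ n = 1 \<and> z ^ j \<noteq> 1 \<and> (z ^ j) ^ c = 1"
    then obtain z :: complex where z: "z ^ n = 1" "z ^ j \<noteq> 1" "(z ^ j) ^ c = 1"
      by blast
    \<comment> \<open>Both sides are the lcm of \<open>n\<close> and \<open>j\<close>. Hence the
      order of \<open>z ^ j\<close> divides \<open>n div ?g\<close> as well as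
      \<open>c\<close>.\<close>
    have "j * (n div ?g) = n * (j div ?g)"
      by (simp add: div_mult_swap mult.commute)
    then have "(z ^ j) ^ (n div ?g) = (z ^ n) ^ (j div ?g)"
      by (simp flip: power_mult)
    then have "(z ^ j) ^ ?d = 1"
      using z by (intro power_gcd_eq_1) simp_all
    then have "?d \<noteq> 1"
      using z(2) by auto
    then show "?d \<ge> 2"
      using d by linarith
  }
  {
    assume d2: "?d \<ge> 2"
    \<comment> \<open>The witness has order \<open>?g * ?d\<close>, which divides \<open>n\<close>
      and \<open>j * c\<close>. If it also divided \<open>j\<close>, it would divide
      \<open>?g\<close>, forcing \<open>?d = 1\<close>.\<close>
    have m: "?g * ?d > 0"
      using assms d by simp
    obtain z :: complex where z: "\<And>e. z ^ e = 1 \<longleftrightarrow> ?g * ?d dvd e"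
      using primitive_root_of_unity[OF m] by blast
    have n: "?g * ?d dvd n"
    proof -
      have "?g * ?d dvd ?g * (n div ?g)"
        by (intro mult_dvd_mono) auto
      then show ?thesis
        by simp
    qed
    have "\<not> ?g * ?d dvd j"
    proof
      assume "?g * ?d dvd j"
      then have "?g * ?d dvd ?g * 1"
        using n by simp
      then show False
        using d2 assms by (simp only: nat_mult_dvd_cancel_disj) auto
    qed
    moreover have "?g * ?d dvd j * c"
      by (intro mult_dvd_mono) auto
    ultimately show "\<exists>z::complex. z ^ n = 1 \<and> z ^ j \<noteq> 1 \<and> (z ^ j) ^ c = 1"
      using n z by (metis power_mult)
  }
qed

section \<open>Singular circulant matrices\<close>

text \<open>Row \<open>u\<close> is row 0 shifted cyclically by \<open>u\<close>. As
  \<open>z ^ n = 1\<close>, exponents count only modulo \<open>n\<close>, so the shift becomes the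
  factor \<open>z ^ u\<close>.\<close>

lemma circulant_row_sum:
  fixes z :: complex
  assumes A: "circulant_mat A" "A \<in> carrier_mat n n" and u: "u < n" and z: "z ^ n = 1"
  shows "(\<Sum>v<n. of_real (A $$ (u, v)) * z ^ v) = z ^ u * (\<Sum>m<n. of_real (A $$ (0, m)) * z ^ m)"
proof -
  have "(\<Sum>v<n. of_real (A $$ (u, v)) * z ^ v) =
      (\<Sum>m<n. of_real (A $$ (0, m)) * (z ^ u * z ^ m))"
  proof (rule sum.reindex_bij_witness[where i = "\<lambda>m. (m + u) mod n" and j = "\<lambda>v. (v + n - u) mod n"])
    fix v assume "v \<in> {..<n}"
    then have v: "v < n" by simp
    have "((v + n - u) mod n + u) mod n = (v + n - u + u) mod n"
      by (rule mod_add_left_eq)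
    then show "((v + n - u) mod n + u) mod n = v"
      using u v by simp
    have "z ^ u * z ^ ((v + n - u) mod n) = z ^ (u + (v + n - u))"
      by (simp add: power_mod_eq[OF z] power_add)
    also have "\<dots> = z ^ v"
      using u z by (simp add: power_add)
    finally show "of_real (A $$ (0, (v + n - u) mod n)) * (z ^ u * z ^ ((v + n - u) mod n)) =
        of_real (A $$ (u, v)) * z ^ v"
      using circulant_mat_entry[OF A u v] by simp
  next
    fix m assume "m \<in> {..<n}"
    then have m: "m < n" by simp
    have "((m + u) mod n + n - u) mod n = ((m + u) mod n + (n - u)) mod n"
      using u by simp
    also have "\<dots> = (m + u + (n - u)) mod n"
      by (rule mod_add_left_eq)
    finally show "((m + u) mod n + n - u) mod n = m"
      using u m by simp
  qed (use u in auto)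
  then show ?thesis
    by (simp add: sum_distrib_left mult_ac)
qed

text \<open>This replaces the invertibility of the Fourier matrix: \<open>n\<close> distinct roots
  are too many for a nonzero polynomial of degree below \<open>n\<close>.\<close>

lemma coeffs_eq_0_if_vanishing_at_roots_of_unity:
  fixes x :: "nat \<Rightarrow> complex"
  assumes "\<And>z. z ^ n = 1 \<Longrightarrow> (\<Sum>u<n. x u * z ^ u) = 0" and u: "u < n"
  shows "x u = 0"
proof -
  define p where "p = (\<Sum>u<n. monom (x u) u)"
  have "p = 0"
  proof (rule poly_eqI_degree[where A = "{z. z ^ n = 1}"])
    show "poly p z = poly 0 z" if "z \<in> {z. z ^ n = 1}" for z
      using assms(1) that by (simp add: p_def poly_sum poly_monom)
    have "degree p < n"
      unfolding p_def using u
      by (intro degree_sum_less) (auto intro: le_less_trans[OF degree_monom_le])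
    then show "degree p < card {z::complex. z ^ n = 1}"
      using u by (simp add: card_roots_unity_eq)
    show "degree (0 :: complex poly) < card {z::complex. z ^ n = 1}"
      using u by (simp add: card_roots_unity_eq)
  qed
  moreover have "coeff p u = x u"
    using u by (simp add: p_def coeff_sum)
  ultimately show ?thesis
    by simp
qed

lemma det_circulant_eq_0_iff:
  assumes A: "circulant_mat A" "A \<in> carrier_mat n n" and n: "n > 0"
  shows "det A = 0 \<longleftrightarrow>
    (\<exists>z::complex. z ^ n = 1 \<and> (\<Sum>m<n. of_real (A $$ (0, m)) * z ^ m) = 0)"
proof -
  \<comment> \<open>The eigenvectors are complex, and the embedding of the reals preserves and
    reflects vanishing of the determinant.\<close>
  define B where "B = map_mat (of_real :: real \<Rightarrow> complex) A"
  have B: "B \<in> carrier_mat n n" "B\<^sup>T \<in> carrier_mat n n"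
    using A(2) by (simp_all add: B_def)
  have entry: "B $$ (u, v) = of_real (A $$ (u, v))" if "u < n" "v < n" for u v
    using A(2) that by (simp add: B_def)
  have "det B = of_real (det A)"
    by (simp add: B_def)
  then have det: "det A = 0 \<longleftrightarrow> det B = 0"
    by simp
  have row: "(\<Sum>v<n. B $$ (u, v) * z ^ v) = z ^ u * (\<Sum>m<n. of_real (A $$ (0, m)) * z ^ m)"
    if "z ^ n = 1" "u < n" for z u
    using circulant_row_sum[OF A that(2,1)] that(2) by (simp add: entry)
  show ?thesis
  proof
    assume "\<exists>z::complex. z ^ n = 1 \<and> (\<Sum>m<n. of_real (A $$ (0, m)) * z ^ m) = 0"
    then obtain z :: complex where z: "z ^ n = 1" "(\<Sum>m<n. of_real (A $$ (0, m)) * z ^ m) = 0"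
      by blast
    define x where "x = vec n (\<lambda>u. z ^ u)"
    have "x $ 0 \<noteq> 0"
      using n by (simp add: x_def)
    then have "x \<noteq> 0\<^sub>v n"
      using n by auto
    moreover have "B *\<^sub>v x = 0\<^sub>v n"
    proof (rule eq_vecI)
      fix u assume "u < dim_vec (0\<^sub>v n :: complex vec)"
      then have u: "u < n" by simp
      have "(B *\<^sub>v x) $ u = (\<Sum>v<n. B $$ (u, v) * z ^ v)"
        using u B by (simp add: x_def scalar_prod_def atLeast0LessThan)
      then show "(B *\<^sub>v x) $ u = 0\<^sub>v n $ u"
        using row[OF z(1) u] z(2) u by simp
    qed (use B in simp)
    moreover have "x \<in> carrier_vec n"
      by (simp add: x_def)
    ultimately show "det A = 0"
      using det det_0_iff_vec_prod_zero[OF B(1)] by blast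
  next
    assume "det A = 0"
    \<comment> \<open>A left kernel vector \<open>x\<close> is paired with each eigenvector.
      Evaluating the double sum by rows and by columns shows that the eigenvalue times the
      polynomial with coefficients \<open>x\<close> is 0 at \<open>z\<close>. If no eigenvalue
      vanishes, that polynomial is 0 at every root of unity, hence \<open>x\<close> is zero.\<close>
    then have "det B\<^sup>T = 0"
      using det det_transpose[OF B(1)] by simp
    then obtain x where x: "x \<in> carrier_vec n" "x \<noteq> 0\<^sub>v n" "B\<^sup>T *\<^sub>v x = 0\<^sub>v n"
      using det_0_iff_vec_prod_zero[OF B(2)] by blast
    have col: "(\<Sum>u<n. B $$ (u, v) * x $ u) = 0" if "v < n" for v
    proof -
      have "(B\<^sup>T *\<^sub>v x) $ v = (\<Sum>u<n. B $$ (u, v) * x $ u)"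
        using that B x(1) by (simp add: scalar_prod_def atLeast0LessThan)
      then show ?thesis
        using x(3) that by simp
    qed
    show "\<exists>z::complex. z ^ n = 1 \<and> (\<Sum>m<n. of_real (A $$ (0, m)) * z ^ m) = 0"
    proof (rule ccontr)
      assume no: "\<not> ?thesis"
      have "(\<Sum>u<n. x $ u * z ^ u) = 0" if z: "z ^ n = 1" for z
      proof -
        let ?\<gamma> = "\<Sum>m<n. of_real (A $$ (0, m)) * z ^ m"
        have "?\<gamma> * (\<Sum>u<n. x $ u * z ^ u) = (\<Sum>u<n. x $ u * (z ^ u * ?\<gamma>))"
          by (subst sum_distrib_left) (simp add: mult_ac)
        also have "\<dots> = (\<Sum>u<n. x $ u * (\<Sum>v<n. B $$ (u, v) * z ^ v))"
          by (intro sum.cong refl) (simp add: row[OF z])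
        also have "\<dots> = (\<Sum>u<n. \<Sum>v<n. z ^ v * (B $$ (u, v) * x $ u))"
          by (simp add: sum_distrib_left mult_ac)
        also have "\<dots> = (\<Sum>v<n. z ^ v * (\<Sum>u<n. B $$ (u, v) * x $ u))"
          by (subst sum.swap) (simp add: sum_distrib_left)
        also have "\<dots> = 0"
          by (simp add: col)
        finally show ?thesis
          using no z by auto
      qed
      then have "x $ u = 0" if "u < n" for u
        using coeffs_eq_0_if_vanishing_at_roots_of_unity[of n "\<lambda>u. x $ u"] that by blast
      then have "x = 0\<^sub>v n"
        using x(1) by (intro eq_vecI) auto
      then show False
        using x(2) by blast
    qed
  qed
qed

text \<open>By the size bound every exponent \<open>s + t * j\<close> lies below \<open>n\<close>,
  so the sum over \<open>m < n\<close> misses no term.\<close>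

lemma C_poly_sum_factorization:
  fixes z :: complex
  assumes "k * j + i + l < n"
  shows "(\<Sum>m<n. of_real (coeff (C_poly i j k l) m) * z ^ m) =
    z ^ i * (\<Sum>s\<le>l. z ^ s) * (\<Sum>t\<le>k. (z ^ j) ^ t)"
proof -
  have lt: "s + t * j < n" if "t \<le> k" "s \<le> i + l" for s t
    using mult_le_mono1[OF that(1), of j] that(2) assms by linarith
  have "(\<Sum>m<n. of_real (coeff (C_poly i j k l) m) * z ^ m) =
      (\<Sum>m<n. \<Sum>t=0..k. \<Sum>s=i..i+l. if s + t * j = m then z ^ m else 0)"
    by (simp add: C_poly_def coeff_sum sum_distrib_right if_distrib if_distribR cong: if_cong)
  also have "\<dots> = (\<Sum>t=0..k. \<Sum>s=i..i+l. \<Sum>m<n. if s + t * j = m then z ^ m else 0)"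
    by (subst sum.swap) (intro sum.cong refl sum.swap)
  also have "\<dots> = (\<Sum>t=0..k. \<Sum>s=i..i+l. z ^ (s + t * j))"
    using lt by (intro sum.cong refl) simp
  also have "\<dots> = (\<Sum>s=i..i+l. z ^ s) * (\<Sum>t=0..k. (z ^ j) ^ t)"
    by (subst sum.swap) (simp add: sum_product power_add mult.commute flip: power_mult)
  also have "(\<Sum>s=i..i+l. z ^ s) = (\<Sum>s=0..l. z ^ (s + i))"
    using sum.shift_bounds_cl_nat_ivl[of "\<lambda>s. z ^ s" 0 i l] by (simp add: add.commute)
  also have "\<dots> = z ^ i * (\<Sum>s\<le>l. z ^ s)"
    by (simp add: power_add sum_distrib_left mult.commute atLeast0AtMost)
  finally show ?thesis
    by (simp add: atLeast0AtMost)
qed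

theorem theorem25:
  fixes n i j k l :: nat
  assumes "n > 0" and "j > l" and "k * j + i + l < n"
  shows "singular_digraph (C_digraph n i j k l) \<longleftrightarrow>
           gcd (l + 1) n \<ge> 2 \<or> gcd (k + 1) (n div gcd n j) \<ge> 2"
proof -
  define A where "A = adjacency_mat (C_digraph n i j k l)"
  have circ: "circulant_mat A"
    by (simp add: A_def C_digraph_def circulant_mat_adjacency)
  have dim: "A \<in> carrier_mat n n"
    by (simp add: A_def adjacency_mat_def C_digraph_def circulant_digraph_def)
  have entry: "A $$ (0, m) = coeff (C_poly i j k l) m" if "m < n" for m
    using representer_poly_C_digraph[OF assms(2,3)] coeff_representer_poly[of A m] dim that
    by (simp add: A_def)
  have "singular_digraph (C_digraph n i j k l) \<longleftrightarrow> det A = 0"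
    using dim by (simp add: singular_digraph_def singular_mat_def A_def)
  also have "\<dots> \<longleftrightarrow> (\<exists>z::complex. z ^ n = 1 \<and>
      (\<Sum>m<n. of_real (coeff (C_poly i j k l) m) * z ^ m) = 0)"
    unfolding det_circulant_eq_0_iff[OF circ dim assms(1)] by (simp add: entry)
  \<comment> \<open>The factor \<open>z ^ i\<close> drops out: \<open>z ^ n = 1\<close> with
    \<open>n > 0\<close> makes \<open>z\<close> nonzero.\<close>
  also have "\<dots> \<longleftrightarrow> (\<exists>z::complex. z ^ n = 1 \<and>
      ((\<Sum>s\<le>l. z ^ s) = 0 \<or> (\<Sum>t\<le>k. (z ^ j) ^ t) = 0))"
    unfolding C_poly_sum_factorization[OF assms(3)]
    using assms(1) by (intro ex_cong) (auto simp: power_0_left)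
  \<comment> \<open>Writing \<open>z ^ 1\<close> matches the shape of
    \<open>ex_nontrivial_root_iff\<close>, where \<open>gcd n 1 = 1\<close> leaves \<open>n\<close>
    itself.\<close>
  also have "\<dots> \<longleftrightarrow>
      (\<exists>z::complex. z ^ n = 1 \<and> z ^ 1 \<noteq> 1 \<and> (z ^ 1) ^ (l + 1) = 1) \<or>
      (\<exists>z::complex. z ^ n = 1 \<and> z ^ j \<noteq> 1 \<and> (z ^ j) ^ (k + 1) = 1)"
    unfolding geometric_sum_eq_0_iff Suc_eq_plus1 power_one_right by blast
  also have "\<dots> \<longleftrightarrow> gcd (l + 1) n \<ge> 2 \<or> gcd (k + 1) (n div gcd n j) \<ge> 2"
    unfolding ex_nontrivial_root_iff[OF assms(1)] by simp
  finally show ?thesis .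
qed

end
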